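(* Let $k,l,s\ge 0$ be integers, let $n=k+2s+l$, and let $\alpha_1,\ldots,\alpha_s\in\mathbb{R}$. Let $A$ be a real orthogonal $n\times n$ matrix that is similar to the block diagonal matrix $$C= I_k\oplus(-I_l)\oplus \begin{pmatrix}\cos\alpha_1 & \sin\alpha_1\\ -\sin\alpha_1 & \cos\alpha_1 \end{pmatrix}\oplus\cdots\oplus\begin{pmatrix}\cos\alpha_s & \sin\alpha_s\\ -\sin\alpha_s & \cos\alpha_s \end{pmatrix},$$ where the eigenvalue $-1$ is repeated an even number of times (i.e. has even multiplicity). Then $A$ has a real orthogonal root, i.e. there exists a real orthogonal $n\times n$ matrix $R$ such that $R^2=A$.
   Context: A matrix $R$ is called a root of $A$ if $A=R^2$. Two $n\times n$ matrices $A$ and $C$ are similar if $A=T^{-1}CT$ for some invertible matrix $T$. The symbol $\oplus$ denotes the direct sum (block diagonal sum) of matrices, and $I_k$ is the $k\times k$ identity matrix (blocks of size $0$ are omitted). *)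

theory Defs
  imports Complex_Main "Jordan_Normal_Form.Char_Poly"
begin

text \<open>
  The library constant \<^const>\<open>orthogonal_mat\<close> only asks for pairwise orthogonal nonzero columns,
  not orthonormal ones. An orthogonal matrix in the usual sense is one whose transpose is its
  inverse.
\<close>

definition real_orthogonal_mat :: "nat \<Rightarrow> real mat \<Rightarrow> bool" where
  "real_orthogonal_mat n A \<longleftrightarrow>
     A \<in> carrier_mat n n \<and>
     transpose_mat A * A = 1\<^sub>m n \<and> A * transpose_mat A = 1\<^sub>m n"

definition rotation_block :: "real \<Rightarrow> real mat" where
  "rotation_block a = mat_of_rows_list 2 [[cos a, sin a], [- sin a, cos a]]"

text \<open>
  The empty blocks \<^term>\<open>1\<^sub>m 0 :: real mat\<close> and \<^term>\<open>- 1\<^sub>m 0 :: real mat\<close> contribute nothing to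
  \<^const>\<open>diag_block_mat\<close>, so the cases of zero \<^term>\<open>k :: nat\<close>, \<^term>\<open>l :: nat\<close> or
  \<^term>\<open>s :: nat\<close> need no special treatment.
\<close>

definition orthogonal_canonical_form :: "nat \<Rightarrow> nat \<Rightarrow> nat \<Rightarrow> (nat \<Rightarrow> real) \<Rightarrow> real mat" where
  "orthogonal_canonical_form k l s \<alpha> =
     diag_block_mat ([1\<^sub>m k, - 1\<^sub>m l] @ map (\<lambda>i. rotation_block (\<alpha> i)) [1..<s + 1])"

end

(* Since -1 has even multiplicity and each rotation block contributes an even multiplicity, l is even,
   so the canonical form C has a blockwise orthogonal root D. Writing A = T^-1 C T, orthogonality of
   A and C makes A commute with T^t T, hence with its symmetric root P, so Q = T P^-1 is orthogonal
   and A = Q^t C Q. The root of A is then Q^t D Q. *)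
theory Submission
  imports Defs "Jordan_Normal_Form.Spectral_Radius"
begin

section \<open>Real orthogonal matrices, their products and their block sums\<close>

lemma mat_mult_cancel_left:
  fixes A B X :: "'a :: semiring_1 mat"
  assumes "A \<in> carrier_mat n m" "B \<in> carrier_mat m n" "X \<in> carrier_mat n k" "A * B = 1\<^sub>m n"
  shows "A * (B * X) = X"
  using assms by (metis assoc_mult_mat left_mult_one_mat)

text \<open>A one-sided inverse of a square matrix is two-sided, so only one of the two identities
  has to be checked.\<close>

lemma real_orthogonal_matI:
  assumes "A \<in> carrier_mat n n" "transpose_mat A * A = 1\<^sub>m n"
  shows "real_orthogonal_mat n A"
  using assms mat_mult_left_right_inverse[of "transpose_mat A" n A]
  by (auto simp: real_orthogonal_mat_def)

lemma real_orthogonal_mat_mult: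
  assumes "real_orthogonal_mat n A" "real_orthogonal_mat n B"
  shows "real_orthogonal_mat n (A * B)"
proof (rule real_orthogonal_matI)
  have A: "A \<in> carrier_mat n n" "transpose_mat A * A = 1\<^sub>m n"
    and B: "B \<in> carrier_mat n n" "transpose_mat B * B = 1\<^sub>m n"
    using assms by (auto simp: real_orthogonal_mat_def)
  show "A * B \<in> carrier_mat n n" using A B by simp
  have "transpose_mat (A * B) * (A * B) = transpose_mat B * (transpose_mat A * (A * B))"
    using A(1) B(1)
    by (simp add: transpose_mult[OF A(1) B(1)] assoc_mult_mat[of _ n n _ n _ n] mult_carrier_mat[of _ n n _ n])
  also have "transpose_mat A * (A * B) = B"
    using A B by (intro mat_mult_cancel_left[of _ n n]) auto
  finally show "transpose_mat (A * B) * (A * B) = 1\<^sub>m n" using B by simp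
qed

lemma real_orthogonal_mat_transpose:
  "real_orthogonal_mat n A \<Longrightarrow> real_orthogonal_mat n (transpose_mat A)"
  by (auto simp: real_orthogonal_mat_def)

lemma pow_mat_2: "A \<in> carrier_mat n n \<Longrightarrow> A ^\<^sub>m 2 = A * A"
  by (simp add: numeral_2_eq_2)

lemma diag_four_block_mult:
  fixes A A' B B' :: "'a :: semiring_0 mat"
  assumes "A \<in> carrier_mat n n" "A' \<in> carrier_mat n n"
    "B \<in> carrier_mat m m" "B' \<in> carrier_mat m m"
  shows "four_block_mat A (0\<^sub>m n m) (0\<^sub>m m n) B * four_block_mat A' (0\<^sub>m n m) (0\<^sub>m m n) B'
    = four_block_mat (A * A') (0\<^sub>m n m) (0\<^sub>m m n) (B * B')"
  using assms by (subst mult_four_block_mat) auto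

lemma diag_four_block_transpose:
  assumes "A \<in> carrier_mat n n" "B \<in> carrier_mat m m"
  shows "transpose_mat (four_block_mat A (0\<^sub>m n m) (0\<^sub>m m n) B)
    = four_block_mat (transpose_mat A) (0\<^sub>m n m) (0\<^sub>m m n) (transpose_mat B)"
  using assms by (subst transpose_four_block_mat[of _ n n _ m _ m]) (auto intro!: eq_matI)

lemma diag_four_block_real_orthogonal:
  assumes "real_orthogonal_mat n A" "real_orthogonal_mat m B"
  shows "real_orthogonal_mat (n + m) (four_block_mat A (0\<^sub>m n m) (0\<^sub>m m n) B)"
  using assms
  by (intro real_orthogonal_matI)
     (auto simp: real_orthogonal_mat_def diag_four_block_mult diag_four_block_transpose)

subsection \<open>The spectral theorem for real symmetric matrices\<close>

text \<open>The vectors v and e_0 are both of length 1, so the reflection in the hyperplane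
  orthogonal to v - e_0 swaps them. A reflection is symmetric and its own inverse, hence orthogonal.
  The case v = e_0 is separate because the hyperplane is then undefined.\<close>

lemma householder:
  fixes v :: "real vec"
  assumes v: "v \<in> carrier_vec n" "v \<bullet> v = 1" and n: "0 < n"
  shows "\<exists>H. real_orthogonal_mat n H \<and> transpose_mat H = H \<and> col H 0 = v"
proof (cases "v = unit_vec n 0")
  case True
  then show ?thesis using n by (intro exI[of _ "1\<^sub>m n"]) (auto simp: real_orthogonal_mat_def)
next
  case False
  define w where "w = v - unit_vec n 0"
  \<comment> \<open>With this factor, \<open>H\<close> below is the reflection I - 2 w w^t / (w .
    w); \<open>d\<close> is the Kronecker delta.\<close>
  define c where "c = 2 / (w \<bullet> w)"
  define d where "d = (\<lambda>i j::nat. if i = j then 1 else 0 :: real)"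
  define H where "H = mat n n (\<lambda>(i,j). d i j - c * w $ i * w $ j)"
  have w: "w \<in> carrier_vec n" using v by (auto simp: w_def)
  have wi: "w $ i = v $ i - d i 0" if "i < n" for i using that v n by (auto simp: w_def d_def)
  have ww: "w \<bullet> w = (\<Sum>i<n. w $ i * w $ i)" using w by (simp add: scalar_prod_def lessThan_atLeast0)
  have "w \<noteq> 0\<^sub>v n"
  proof
    assume "w = 0\<^sub>v n"
    then have "v $ i = unit_vec n 0 $ i" if "i < n" for i
      using wi[OF that] that n by (auto simp: d_def)
    then show False using False v by (auto intro!: eq_vecI)
  qed
  then have ww0: "w \<bullet> w \<noteq> 0" using w conjugate_square_eq_0_vec[of w n] by auto
  \<comment> \<open>Since v is a unit vector, w . w = 2 - 2 v_0 = -2 w_0. Hence c w_0 = -1, and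
    column 0 of \<open>H\<close> becomes e_0 + w = v.\<close>
  have "w \<bullet> w = (\<Sum>i<n. v $ i * v $ i - 2 * (if i = 0 then v $ i else 0) + d i 0)"
    unfolding ww by (rule sum.cong) (auto simp: wi d_def algebra_simps)
  also have "\<dots> = 2 - 2 * v $ 0"
    using v n by (simp add: sum.distrib sum_subtractf scalar_prod_def lessThan_atLeast0 d_def
        flip: sum_distrib_left)
  finally have c0: "c * w $ 0 = -1" using ww0 wi[OF n] by (simp add: c_def d_def field_simps)
  have H: "H \<in> carrier_mat n n" by (simp add: H_def)
  have sym: "transpose_mat H = H" by (rule eq_matI) (auto simp: H_def d_def)
  have "H * H = 1\<^sub>m n"
  proof (rule eq_matI)
    fix i j assume "i < dim_row (1\<^sub>m n :: real mat)" "j < dim_col (1\<^sub>m n :: real mat)"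
    then have ij: "i < n" "j < n" by auto
    have "(H * H) $$ (i,j) = (\<Sum>k<n. (d i k - c * w $ i * w $ k) * (d k j - c * w $ k * w $ j))"
      using ij by (simp add: H_def scalar_prod_def lessThan_atLeast0)
    \<comment> \<open>Each delta is turned into an \<open>if\<close> on the summation index so that
      its sum collapses. The two cross terms then cancel against the quadratic term, because c (w .
      w) = 2.\<close>
    also have "\<dots> = (\<Sum>k<n. (if k = i then d k j else 0)
        - (if k = i then c * w $ k * w $ j else 0) - (if k = j then c * w $ i * w $ k else 0)
        + c * c * w $ i * w $ j * (w $ k * w $ k))"
      by (rule sum.cong) (auto simp: d_def algebra_simps)
    also have "\<dots> = d i j - 2 * c * w $ i * w $ j + c * c * w $ i * w $ j * (w \<bullet> w)"
      unfolding ww sum.distrib sum_subtractf using ij by (simp add: sum_distrib_left)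
    also have "\<dots> = d i j" using ww0 by (simp add: c_def field_simps)
    finally show "(H * H) $$ (i,j) = 1\<^sub>m n $$ (i,j)" using ij by (simp add: d_def)
  qed (auto simp: H_def)
  moreover have "col H 0 = v"
  proof (rule eq_vecI)
    fix i assume i: "i < dim_vec v"
    then have "i < n" using v by auto
    then have "col H 0 $ i = d i 0 - (c * w $ 0) * w $ i" using n by (simp add: H_def)
    then show "col H 0 $ i = v $ i" using wi[OF \<open>i < n\<close>] by (simp add: c0)
  qed (use v H in auto)
  ultimately show ?thesis using H sym by (auto intro!: exI[of _ H] real_orthogonal_matI)
qed

text \<open>An eigenvalue exists over the complex numbers; symmetry forces it to be real, and a real
  eigenvector for it is then scaled to length 1.\<close>

lemma real_symmetric_eigenvalue:
  fixes S :: "real mat"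
  assumes S: "S \<in> carrier_mat n n" and sym: "transpose_mat S = S" and n: "0 < n"
  shows "\<exists>a v. v \<in> carrier_vec n \<and> v \<bullet> v = 1 \<and> S *\<^sub>v v = a \<cdot>\<^sub>v v"
proof -
  define M where "M = map_mat complex_of_real S"
  have M: "M \<in> carrier_mat n n" using S by (simp add: M_def)
  obtain z where "z \<in> spectrum M" using spectrum_non_empty[OF M] n by auto
  then have ez: "eigenvalue M z" by (simp add: spectrum_def)
  then obtain u where u: "u \<in> carrier_vec n" "u \<noteq> 0\<^sub>v n" "M *\<^sub>v u = z \<cdot>\<^sub>v u"
    using M by (auto simp: eigenvalue_def eigenvector_def)
  have cM: "conjugate (M *\<^sub>v u) = M *\<^sub>v conjugate u"
    using S u(1) by (intro eq_vecI) (auto simp: M_def scalar_prod_def)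
  have "transpose_mat M = map_mat complex_of_real (transpose_mat S)" by (auto simp: M_def)
  then have tM: "transpose_mat M = M" by (simp add: sym M_def)
  have "z * (u \<bullet>c u) = (M *\<^sub>v u) \<bullet>c u" using u by simp
  \<comment> \<open>\<open>M\<close> is symmetric with real entries, so it moves across the
    Hermitian product and commutes with conjugation. Comparing both ends gives z = cnj z.\<close>
  also have "\<dots> = u \<bullet> (M *\<^sub>v conjugate u)"
    using transpose_vec_mult_scalar[OF M _ u(1), of "conjugate u"] u(1) M tM
      by (metis assoc_scalar_prod carrier_vec_conjugate transpose_vec_mult_scalar)
  also have "\<dots> = cnj z * (u \<bullet>c u)" using u by (simp add: conjugate_smult_vec flip: cM)
  finally have "z = cnj z" using u conjugate_square_eq_0_vec[of u n] by auto
  then have z: "z = complex_of_real (Re z)" by (simp add: complex_eq_iff)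
  \<comment> \<open>The eigenvector \<open>u\<close> may be genuinely complex. A real eigenvector is
    obtained instead from the real root that \<open>z\<close> gives of the characteristic polynomial
    of \<open>S\<close>.\<close>
  have "poly (char_poly M) z = 0" using ez eigenvalue_root_char_poly[OF M] by simp
  then have "poly (char_poly S) (Re z) = 0"
    unfolding M_def of_real_hom.char_poly_hom[OF S] by (subst (asm) z) simp
  then have "eigenvalue S (Re z)" using eigenvalue_root_char_poly[OF S] by simp
  then obtain x where x: "x \<in> carrier_vec n" "x \<noteq> 0\<^sub>v n" "S *\<^sub>v x = Re z \<cdot>\<^sub>v x"
    using S by (auto simp: eigenvalue_def eigenvector_def)
  have "x \<bullet> x > 0" using x conjugate_square_greater_0_vec[of x n] by auto
  then have "((1 / sqrt (x \<bullet> x)) \<cdot>\<^sub>v x) \<bullet> ((1 / sqrt (x \<bullet> x)) \<cdot>\<^sub>v x) = 1"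
    using x by simp
  moreover have "S *\<^sub>v ((1 / sqrt (x \<bullet> x)) \<cdot>\<^sub>v x) = Re z \<cdot>\<^sub>v ((1 / sqrt (x \<bullet> x)) \<cdot>\<^sub>v x)"
    using x by (simp add: mult_mat_vec[OF S] smult_smult_assoc mult.commute)
  ultimately show ?thesis using x(1) by (meson smult_carrier_vec)
qed

text \<open>Induction by deflation: a reflection carries a unit eigenvector to e_0, which splits off
  a 1x1 block and leaves a smaller symmetric matrix.\<close>

lemma real_spectral_theorem:
  fixes S :: "real mat"
  assumes "S \<in> carrier_mat n n" "transpose_mat S = S"
  shows "\<exists>U d. real_orthogonal_mat n U \<and> transpose_mat U * S * U = mat_diag n d"
  using assms
proof (induction n arbitrary: S)
  case 0
  then show ?case by (intro exI[of _ "1\<^sub>m 0"] exI[of _ "\<lambda>_. 0"])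
     (auto simp: real_orthogonal_mat_def mat_diag_def intro!: eq_matI)
next
  case (Suc n)
  let ?N = "Suc n"
  note S = Suc.prems
  obtain a v where v: "v \<in> carrier_vec ?N" "v \<bullet> v = 1" "S *\<^sub>v v = a \<cdot>\<^sub>v v"
    using real_symmetric_eigenvalue[OF S] by auto
  obtain H where H: "real_orthogonal_mat ?N H" "transpose_mat H = H" "col H 0 = v"
    using householder[OF v(1,2)] by auto
  have Hc: "H \<in> carrier_mat ?N ?N" and HH: "H * H = 1\<^sub>m ?N"
    using H by (auto simp: real_orthogonal_mat_def)
  \<comment> \<open>As \<open>H\<close> swaps e_0 and v, the first column of \<open>M\<close> is a
    e_0; by symmetry the first row is too.\<close>
  define M where "M = H * S * H"
  have M: "M \<in> carrier_mat ?N ?N" using Hc S by (simp add: M_def)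
  have Msym: "transpose_mat M = M"
    using Hc S(1) unfolding M_def
    by (simp add: transpose_mult[of _ ?N ?N _ ?N] mult_carrier_mat[of _ ?N ?N _ ?N] H S(2)
        assoc_mult_mat[of _ ?N ?N _ ?N _ ?N])
  have "col M 0 = H *\<^sub>v (S *\<^sub>v col H 0)"
  proof -
    have SH: "S * H \<in> carrier_mat ?N ?N" using S(1) Hc by simp
    have "M = H * (S * H)" unfolding M_def by (rule assoc_mult_mat[OF Hc S(1) Hc])
    then show ?thesis
      by (simp only: col_mult2[OF Hc SH zero_less_Suc] col_mult2[OF S(1) Hc zero_less_Suc])
  qed
  also have "\<dots> = a \<cdot>\<^sub>v (H *\<^sub>v col H 0)" using v Hc H by (simp add: mult_mat_vec[OF Hc])
  also have "H *\<^sub>v col H 0 = col (H * H) 0" by (rule col_mult2[OF Hc Hc zero_less_Suc, symmetric])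
  finally have col0: "col M 0 = a \<cdot>\<^sub>v unit_vec ?N 0" by (simp add: HH)
  have M0: "M $$ (i, 0) = (if i = 0 then a else 0)" if "i < ?N" for i
    using arg_cong[OF col0, of "\<lambda>x. x $ i"] that M by auto
  have Mij: "M $$ (i, j) = M $$ (j, i)" if "i < ?N" "j < ?N" for i j
    using arg_cong[OF Msym, of "\<lambda>x. x $$ (i, j)"] that M by auto
  define S' where "S' = mat n n (\<lambda>(i,j). M $$ (Suc i, Suc j))"
  have S': "S' \<in> carrier_mat n n" by (simp add: S'_def)
  have "transpose_mat S' = S'" by (rule eq_matI) (auto simp: S'_def Mij)
  from Suc.IH[OF S' this] obtain U d where
    U: "real_orthogonal_mat n U" and d: "transpose_mat U * S' * U = mat_diag n d" by auto
  have Uc: "U \<in> carrier_mat n n" using U by (simp add: real_orthogonal_mat_def)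
  let ?A = "mat 1 1 (\<lambda>_. a)"
  have Mblock: "M = four_block_mat ?A (0\<^sub>m 1 n) (0\<^sub>m n 1) S'"
  proof (rule eq_matI)
    fix i j assume "i < dim_row (four_block_mat ?A (0\<^sub>m 1 n) (0\<^sub>m n 1) S')"
      "j < dim_col (four_block_mat ?A (0\<^sub>m 1 n) (0\<^sub>m n 1) S')"
    then have ij: "i < ?N" "j < ?N" by (auto simp: S'_def)
    then show "M $$ (i, j) = four_block_mat ?A (0\<^sub>m 1 n) (0\<^sub>m n 1) S' $$ (i, j)"
      using M0[OF ij(1)] M0[OF ij(2)] Mij[OF ij] by (auto simp: S'_def)
  qed (use M in \<open>auto simp: S'_def\<close>)
  define V where "V = four_block_mat (1\<^sub>m 1) (0\<^sub>m 1 n) (0\<^sub>m n 1) U"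
  have V: "real_orthogonal_mat ?N V"
    using diag_four_block_real_orthogonal[of 1 "1\<^sub>m 1" n U] U
    by (simp add: V_def real_orthogonal_mat_def)
  then have Vc: "V \<in> carrier_mat ?N ?N" by (simp add: real_orthogonal_mat_def)
  have "transpose_mat V * M * V
      = four_block_mat ?A (0\<^sub>m 1 n) (0\<^sub>m n 1) (transpose_mat U * S' * U)"
    using Uc S' unfolding V_def Mblock
    by (subst diag_four_block_transpose, simp, simp)
       (simp add: diag_four_block_mult mult_carrier_mat[of _ n n _ n])
  \<comment> \<open>The split-off eigenvalue takes position 0, so the eigenvalues of the smaller
    block shift by one.\<close>
  also have "\<dots> = mat_diag ?N (\<lambda>i. if i = 0 then a else d (i - 1))"
    unfolding d by (rule eq_matI) (auto simp: mat_diag_def)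
  finally have "transpose_mat V * M * V = mat_diag ?N (\<lambda>i. if i = 0 then a else d (i - 1))" .
  \<comment> \<open>The diagonalising matrix is \<open>H * V\<close>; the symmetry of
    \<open>H\<close> lets \<open>H\<close> stand for its own transpose.\<close>
  moreover have "transpose_mat V * M * V = transpose_mat (H * V) * S * (H * V)"
    using Hc Vc S(1) unfolding M_def
    by (simp add: transpose_mult[OF Hc Vc] H(2) mult_carrier_mat[of _ ?N ?N _ ?N]
        assoc_mult_mat[of _ ?N ?N _ ?N _ ?N])
  ultimately show ?case using real_orthogonal_mat_mult[OF H(1) V] by metis
qed

subsection \<open>Similar orthogonal matrices are orthogonally similar\<close>

text \<open>In an orthonormal eigenbasis of T^t T one takes square roots of the eigenvalues. The
  commutation clause serves to show later that \<open>A\<close>, which commutes with T^t T, also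
  commutes with \<open>P\<close>.\<close>

lemma gram_mat_root:
  fixes T :: "real mat"
  assumes T: "T \<in> carrier_mat n n"
  shows "\<exists>P. P \<in> carrier_mat n n \<and> transpose_mat P = P \<and> P * P = transpose_mat T * T \<and>
    (\<forall>B \<in> carrier_mat n n. B * (transpose_mat T * T) = transpose_mat T * T * B \<longrightarrow> B * P = P * B)"
proof -
  define S where "S = transpose_mat T * T"
  have S: "S \<in> carrier_mat n n" using T by (simp add: S_def)
  have "transpose_mat S = S" using T by (simp add: S_def transpose_mult[of _ n n _ n])
  then obtain U d where Uo: "real_orthogonal_mat n U"
    and d: "transpose_mat U * S * U = mat_diag n d"
    using real_spectral_theorem[OF S] by blast
  define V where "V = transpose_mat U"
  have U: "U \<in> carrier_mat n n" and V: "V \<in> carrier_mat n n" and VU: "V * U = 1\<^sub>m n"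
    and UV: "U * V = 1\<^sub>m n"
    using Uo by (auto simp: V_def real_orthogonal_mat_def)
  note assoc = assoc_mult_mat[of _ n n _ n _ n] mult_carrier_mat[of _ n n _ n]
  \<comment> \<open>Products are kept associated to the right, so an inverse pair has to be
    cancelled together with the tail \<open>X\<close> that follows it.\<close>
  have VUX: "V * (U * X) = X" and UVX: "U * (V * X) = X" if "X \<in> carrier_mat n n" for X
    using mat_mult_cancel_left[where k = n, OF V U that VU] mat_mult_cancel_left[where k = n, OF U V that UV] by auto
  \<comment> \<open>The i-th eigenvalue is the squared length of column i of \<open>T * U\<close>,
    so its square root is legitimate.\<close>
  have d0: "d i \<ge> 0" if i: "i < n" for i
  proof -
    define W where "W = T * U"
    have W: "W \<in> carrier_mat n n" using T U by (simp add: W_def)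
    have "mat_diag n d = transpose_mat W * W"
      unfolding d[symmetric] S_def W_def using T U by (simp add: assoc transpose_mult[OF T U])
    moreover have "mat_diag n d $$ (i,i) = d i" using i by (simp add: mat_diag_def)
    ultimately have "d i = (transpose_mat W * W) $$ (i,i)" by simp
    also have "\<dots> = col W i \<bullet> col W i" using i W by simp
    also have "\<dots> \<ge> 0" by (simp add: scalar_prod_def sum_nonneg)
    finally show ?thesis .
  qed
  define E where "E = mat_diag n (\<lambda>i. sqrt (d i))"
  have E: "E \<in> carrier_mat n n" by (simp add: E_def)
  have EE: "E * E = mat_diag n d"
    unfolding E_def mat_diag_diag using d0 by (auto simp: mat_diag_def)
  have SU: "U * (mat_diag n d * V) = S"
    unfolding d[folded V_def, symmetric] using U V S by (simp add: assoc VU UV VUX UVX)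
  define P where "P = U * (E * V)"
  have P: "P \<in> carrier_mat n n" using U V E by (simp add: P_def)
  have tE: "transpose_mat E = E" by (rule eq_matI) (auto simp: E_def mat_diag_def)
  have tP: "transpose_mat P = P"
    using U V E tE unfolding P_def V_def
    by (simp add: transpose_mult[of _ n n _ n] assoc)
  have "P * P = U * ((E * E) * V)"
    using U V E unfolding P_def by (simp add: assoc VUX)
  then have PP: "P * P = S" by (simp add: EE SU)
  have "B * P = P * B" if B: "B \<in> carrier_mat n n" and comm: "B * S = S * B" for B
  proof -
    define B' where "B' = V * (B * U)"
    have B': "B' \<in> carrier_mat n n" using B U V by (simp add: B'_def)
    have D: "mat_diag n d = V * (S * U)" using d S U V by (simp add: V_def assoc)
    have "B' * mat_diag n d = V * ((B * S) * U)"
      using B U V S unfolding D B'_def by (simp add: assoc UVX)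
    also have "\<dots> = mat_diag n d * B'"
      using B U V S unfolding D B'_def comm by (simp add: assoc UVX)
    finally have *: "B' * mat_diag n d = mat_diag n d * B'" .
    have "B' $$ (i,j) * sqrt (d j) = sqrt (d i) * B' $$ (i,j)" if "i < n" "j < n" for i j
    proof -
      have "B' $$ (i,j) * d j = d i * B' $$ (i,j)"
        using arg_cong[OF *, of "\<lambda>X. X $$ (i,j)"] that
        by (simp add: mat_diag_mult_left[OF B'] mat_diag_mult_right[OF B'])
      \<comment> \<open>In the eigenbasis, \<open>B'\<close> couples only equal eigenvalues, and
        these have equal square roots.\<close>
      then have "B' $$ (i,j) = 0 \<or> d i = d j" by auto
      then show ?thesis by auto
    qed
    then have BE: "B' * E = E * B'"
      unfolding E_def mat_diag_mult_left[OF B'] mat_diag_mult_right[OF B'] by (intro eq_matI) auto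
    have "B * P = U * ((B' * E) * V)"
      using B U V E unfolding P_def B'_def by (simp add: assoc UVX)
    also have "\<dots> = P * B"
      using B U V E unfolding BE unfolding P_def B'_def by (simp add: assoc UV)
    finally show ?thesis .
  qed
  then show ?thesis using P tP PP unfolding S_def by blast
qed

text \<open>The similarity matrix \<open>T\<close> is replaced by the orthogonal factor of its polar
  decomposition T = Q P. This factor still intertwines \<open>A\<close> and \<open>C\<close> because
  \<open>P\<close> commutes with \<open>A\<close>.\<close>

lemma similar_real_orthogonal:
  assumes A: "real_orthogonal_mat n A" and C: "real_orthogonal_mat n C" and "similar_mat A C"
  shows "\<exists>Q. real_orthogonal_mat n Q \<and> A = transpose_mat Q * C * Q"
proof -
  note assoc = assoc_mult_mat[of _ n n _ n _ n] mult_carrier_mat[of _ n n _ n]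
  have Ac: "A \<in> carrier_mat n n" and Cc: "C \<in> carrier_mat n n"
    and AtA: "A * transpose_mat A = 1\<^sub>m n" and CtC: "transpose_mat C * C = 1\<^sub>m n"
    using A C by (auto simp: real_orthogonal_mat_def)
  from similar_matD[OF assms(3)] obtain m T' T where
    "{A, C, T', T} \<subseteq> carrier_mat m m" "T' * T = 1\<^sub>m m" "T * T' = 1\<^sub>m m" "A = T' * C * T"
    by blast
  moreover from this Ac have "m = n" by auto
  ultimately have T: "T \<in> carrier_mat n n"
    and T': "T' \<in> carrier_mat n n" and TT': "T * T' = 1\<^sub>m n" and T'T: "T' * T = 1\<^sub>m n"
    and sim: "A = T' * C * T"
    by auto
  have TA: "T * A = C * T"
    unfolding sim using T T' Cc by (simp add: assoc mat_mult_cancel_left[where k = n, OF T T' _ TT'])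
  let ?S = "transpose_mat T * T"
  have S: "?S \<in> carrier_mat n n" using T by simp
  \<comment> \<open>T A = C T and the orthogonality of \<open>C\<close> give A^t S A = S for S = T^t
    T. Multiplying by \<open>A\<close> on the left turns this into A S = S A.\<close>
  have "transpose_mat A * ?S * A = transpose_mat (T * A) * (T * A)"
    using T Ac by (simp add: assoc transpose_mult[OF T Ac])
  also have "\<dots> = transpose_mat T * (transpose_mat C * (C * T))"
    unfolding TA using T Cc by (simp add: assoc transpose_mult[OF Cc T])
  also have "\<dots> = ?S" using T Cc by (subst mat_mult_cancel_left[where k = n, OF _ Cc T CtC]) auto
  finally have "A * (transpose_mat A * ?S * A) = A * ?S" by simp
  then have "A * ?S = ?S * A"
    using Ac S T by (simp add: assoc mat_mult_cancel_left[where k = n, OF Ac _ _ AtA])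
  then obtain P where P: "P \<in> carrier_mat n n" "transpose_mat P = P" "P * P = ?S"
    and AP: "A * P = P * A"
    using gram_mat_root[OF T] Ac by blast
  \<comment> \<open>The inverse of \<open>P\<close> is P (T^t T)^-1, where T' T'^t is the inverse of
    T^t T.\<close>
  have "P * P * (T' * transpose_mat T') = transpose_mat T * (T * (T' * transpose_mat T'))"
    unfolding P(3) using T T' by (simp add: assoc)
  also have "\<dots> = transpose_mat (T' * T)"
    using T T' by (simp add: mat_mult_cancel_left[where k = n, OF T T' _ TT'] transpose_mult[OF T' T])
  finally have "P * (P * (T' * transpose_mat T')) = 1\<^sub>m n" using P(1) T' by (simp add: T'T assoc)
  moreover define N where "N = P * (T' * transpose_mat T')"
  ultimately have PN: "P * N = 1\<^sub>m n" and N: "N \<in> carrier_mat n n" using P T' by auto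
  have NP: "N * P = 1\<^sub>m n" by (rule mat_mult_left_right_inverse[OF P(1) N PN])
  have NPX: "N * (P * X) = X" if "X \<in> carrier_mat n n" for X
    by (rule mat_mult_cancel_left[where k = n, OF N P(1) that NP])
  have tNP: "transpose_mat N * P = 1\<^sub>m n"
    using arg_cong[OF PN, of transpose_mat] P by (simp add: transpose_mult[OF P(1) N])
  define Q where "Q = T * N"
  have Q: "Q \<in> carrier_mat n n" using T N by (simp add: Q_def)
  \<comment> \<open>Here T^t T is rewritten as P P, and each factor \<open>P\<close> meets the
    inverse \<open>N\<close> or its transpose.\<close>
  have "transpose_mat Q * Q = transpose_mat N * ((transpose_mat T * T) * N)"
    using T N by (simp add: Q_def transpose_mult[OF T N] assoc)
  also have "\<dots> = (transpose_mat N * P) * (P * N)"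
    unfolding P(3)[symmetric] using P(1) N by (simp add: assoc)
  finally have tQQ: "transpose_mat Q * Q = 1\<^sub>m n" by (simp add: tNP PN)
  have "N * A = N * ((A * P) * N)" using N Ac P by (simp add: assoc PN)
  also have "\<dots> = A * N" unfolding AP using N Ac P by (simp add: assoc NPX)
  finally have NA: "N * A = A * N" .
  \<comment> \<open>C Q = C T N = T A N = T N A = Q A, the third equality because \<open>N\<close>,
    the inverse of \<open>P\<close>, also commutes with \<open>A\<close>.\<close>
  have "C * Q = (T * A) * N" unfolding TA Q_def using T N Cc by (simp add: assoc)
  also have "\<dots> = Q * A" using T N Ac by (simp add: Q_def assoc NA)
  finally have "transpose_mat Q * C * Q = transpose_mat Q * (Q * A)" using Q Cc by (simp add: assoc)
  also have "\<dots> = A" by (rule mat_mult_cancel_left[where k = n, OF _ Q Ac tQQ]) (use Q in simp)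
  finally show ?thesis using real_orthogonal_matI[OF Q tQQ] by metis
qed

subsection \<open>The canonical form\<close>

lemma rotation_block_carrier: "rotation_block a \<in> carrier_mat 2 2"
  by (auto simp: rotation_block_def mat_of_rows_list_def)

lemma rotation_block_index:
  "rotation_block a $$ (0,0) = cos a" "rotation_block a $$ (0,Suc 0) = sin a"
  "rotation_block a $$ (Suc 0,0) = - sin a" "rotation_block a $$ (Suc 0,Suc 0) = cos a"
  by (auto simp: rotation_block_def mat_of_rows_list_def)

lemma rotation_block_orthogonal: "real_orthogonal_mat 2 (rotation_block a)"
proof (rule real_orthogonal_matI)
  show "transpose_mat (rotation_block a) * rotation_block a = 1\<^sub>m 2"
    using rotation_block_carrier[of a] sin_cos_squared_add[of a]
    by (intro eq_matI)
       (auto simp: scalar_prod_def less_Suc_eq rotation_block_index power2_eq_square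
         numeral_2_eq_2 algebra_simps)
qed (rule rotation_block_carrier)

lemma rotation_block_mult: "rotation_block a * rotation_block b = rotation_block (a + b)"
  using rotation_block_carrier[of a] rotation_block_carrier[of b] rotation_block_carrier[of "a + b"]
  by (intro eq_matI)
     (auto simp: scalar_prod_def less_Suc_eq rotation_block_index numeral_2_eq_2
       cos_add sin_add)

text \<open>The size is read off the matrix, so that one predicate applies to all blocks of a list
  whatever their sizes.\<close>

definition has_orthogonal_root :: "real mat \<Rightarrow> bool" where
  "has_orthogonal_root C \<longleftrightarrow>
     (\<exists>D. real_orthogonal_mat (dim_row C) D \<and> D * D = C)"

lemma one_has_orthogonal_root: "has_orthogonal_root (1\<^sub>m k)"
  by (auto simp: has_orthogonal_root_def real_orthogonal_mat_def intro!: exI[of _ "1\<^sub>m k"])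

text \<open>Halve the angle.\<close>

lemma rotation_block_has_orthogonal_root: "has_orthogonal_root (rotation_block a)"
  using rotation_block_orthogonal[of "a / 2"] rotation_block_mult[of "a / 2" "a / 2"]
    rotation_block_carrier[of a]
  by (auto simp: has_orthogonal_root_def intro!: exI[of _ "rotation_block (a / 2)"])

text \<open>In even dimension the standard complex structure \<open>J\<close> squares to -1. It is
  antisymmetric, so J^t J = -J J = 1.\<close>

lemma uminus_one_has_orthogonal_root:
  assumes "even l"
  shows "has_orthogonal_root (- 1\<^sub>m l)"
proof -
  obtain m where l: "l = m + m" using assms by (metis evenE mult_2)
  define J :: "real mat" where "J = four_block_mat (0\<^sub>m m m) (1\<^sub>m m) (- 1\<^sub>m m) (0\<^sub>m m m)"
  have Jc: "J \<in> carrier_mat l l" by (simp add: J_def l)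
  have tJ: "transpose_mat J = - J"
    by (rule eq_matI) (auto simp: J_def)
  have JJ: "J * J = - 1\<^sub>m l"
    unfolding J_def l by (subst mult_four_block_mat[of _ m m _ m _ m]) (auto intro!: eq_matI)
  have "transpose_mat J * J = 1\<^sub>m l" unfolding tJ using JJ Jc by simp
  then show ?thesis
    using JJ Jc by (auto simp: has_orthogonal_root_def intro!: exI[of _ J] real_orthogonal_matI)
qed

lemma diag_block_mat_has_orthogonal_root:
  assumes "\<And>C. C \<in> set Cs \<Longrightarrow> has_orthogonal_root C"
  shows "has_orthogonal_root (diag_block_mat Cs)"
  using assms
proof (induction Cs)
  case Nil
  then show ?case by (auto simp: has_orthogonal_root_def real_orthogonal_mat_def intro!: exI[of _ "1\<^sub>m 0"])
next
  case (Cons C Cs)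
  let ?B = "diag_block_mat Cs"
  obtain D where D: "real_orthogonal_mat (dim_row C) D" "D * D = C"
    using Cons.prems[of C] by (auto simp: has_orthogonal_root_def)
  obtain E where E: "real_orthogonal_mat (dim_row ?B) E" "E * E = ?B"
    using Cons by (auto simp: has_orthogonal_root_def)
  have c: "D \<in> carrier_mat (dim_row C) (dim_row C)" "E \<in> carrier_mat (dim_row ?B) (dim_row ?B)"
    using D E by (auto simp: real_orthogonal_mat_def)
  \<comment> \<open>The predicate mentions only the number of rows; that the blocks are square
    follows from their being squares of square matrices.\<close>
  then have "dim_col C = dim_row C" "dim_col ?B = dim_row ?B"
    using D(2) E(2) by (metis carrier_matD(2) index_mult_mat(3))+
  then show ?case
    using diag_four_block_real_orthogonal[OF D(1) E(1)] diag_four_block_mult[OF c(1) c(1) c(2) c(2)]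
    unfolding has_orthogonal_root_def by (auto simp: Let_def D E)
qed

section \<open>Characteristic polynomials and the parity of the multiplicity of -1\<close>

lemma char_poly_diag_four_block:
  fixes A B :: "'a :: idom mat"
  assumes A: "A \<in> carrier_mat n n" and B: "B \<in> carrier_mat m m"
  shows "char_poly (four_block_mat A (0\<^sub>m n m) (0\<^sub>m m n) B) = char_poly A * char_poly B"
proof -
  have "char_poly_matrix (four_block_mat A (0\<^sub>m n m) (0\<^sub>m m n) B)
      = four_block_mat (char_poly_matrix A) (0\<^sub>m n m) (0\<^sub>m m n) (char_poly_matrix B)"
    by (rule eq_matI) (use A B in \<open>auto simp: char_poly_matrix_def\<close>)
  then show ?thesis
    using A B by (simp add: char_poly_def det_four_block_mat_upper_right_zero[of _ n _ m])
qed

lemma char_poly_diag_block_mat: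
  fixes As :: "'a :: idom mat list"
  assumes "\<And>A. A \<in> set As \<Longrightarrow> square_mat A"
  shows "char_poly (diag_block_mat As) = prod_list (map char_poly As)"
  using assms
proof (induction As)
  case Nil
  show ?case by (simp add: char_poly_def char_poly_matrix_def)
next
  case (Cons A As)
  let ?B = "diag_block_mat As"
  have sq: "square_mat A" "square_mat ?B"
    using Cons.prems by (auto simp del: square_mat.simps intro!: diag_block_mat_square)
  then have dims: "dim_col A = dim_row A" "dim_col ?B = dim_row ?B" by auto
  then have "A \<in> carrier_mat (dim_row A) (dim_row A)" "?B \<in> carrier_mat (dim_row ?B) (dim_row ?B)"
    by (metis carrier_matI)+
  then have "char_poly (diag_block_mat (A # As)) = char_poly A * char_poly ?B"
    unfolding diag_block_mat.simps Let_def dims by (rule char_poly_diag_four_block)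
  then show ?case using Cons by simp
qed

lemma char_poly_rotation_block: "char_poly (rotation_block a) = [:1, - 2 * cos a, 1:]"
proof -
  \<comment> \<open>Entries are wrapped as 1x1 matrices so that the block determinant formula
    applies; its commutation condition is trivial for such blocks.\<close>
  define q :: "real poly \<Rightarrow> real poly mat" where "q = (\<lambda>c. mat 1 1 (\<lambda>_. c))"
  have q: "q c \<in> carrier_mat 1 1" for c by (simp add: q_def)
  have qq: "q c * q d = q (c * d)" for c d
    by (rule eq_matI) (auto simp: q_def scalar_prod_def)
  have "char_poly_matrix (rotation_block a)
      = four_block_mat (q [:- cos a, 1:]) (q [:- sin a:]) (q [:sin a:]) (q [:- cos a, 1:])"
    using rotation_block_carrier[of a]
    by (intro eq_matI)
       (auto simp: char_poly_matrix_def q_def less_Suc_eq numeral_2_eq_2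
         rotation_block_index)
  moreover have "det (four_block_mat (q b) (q c) (q d) (q e)) = det (q (b * e) - q (c * d))"
    for b c d e
    unfolding qq[symmetric]
    by (rule det_four_block_mat[OF q q q q]) (simp only: qq mult.commute)
  ultimately have "char_poly (rotation_block a)
      = det (q ([:- cos a, 1:] * [:- cos a, 1:]) - q ([:- sin a:] * [:sin a:]))"
    unfolding char_poly_def by metis
  also have "\<dots> = [:- cos a, 1:] * [:- cos a, 1:] - [:- sin a:] * [:sin a:]"
    by (subst det_single) (auto simp: q_def)
  finally show ?thesis
    using sin_cos_squared_add[of a] by (simp add: power2_eq_square add.commute)
qed

text \<open>The value of X^2 - 2 cos(a) X + 1 at -1 is 2 + 2 cos a. It vanishes only for cos a = -1,
  and then the polynomial is (X + 1)^2.\<close>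

lemma even_order_rotation_block:
  "even (Polynomial.order (- 1) (char_poly (rotation_block a)))"
proof (cases "cos a = - 1")
  case True
  have "char_poly (rotation_block a) = [:- (- 1), 1:] ^ 2"
    by (simp add: char_poly_rotation_block True power2_eq_square)
  then show ?thesis by (simp only: order_power_n_n) simp
next
  case False
  then have "poly (char_poly (rotation_block a)) (- 1) \<noteq> 0"
    by (simp add: char_poly_rotation_block)
  then show ?thesis by (simp add: order_0I)
qed

lemma char_poly_smult_one:
  "char_poly (c \<cdot>\<^sub>m 1\<^sub>m k :: 'a :: idom mat) = [:- c, 1:] ^ k"
proof -
  have "char_poly (c \<cdot>\<^sub>m 1\<^sub>m k :: 'a mat) = (\<Prod>a\<leftarrow>diag_mat (c \<cdot>\<^sub>m 1\<^sub>m k). [:- a, 1:])"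
    by (rule char_poly_upper_triangular[of _ k]) auto
  also have "diag_mat (c \<cdot>\<^sub>m 1\<^sub>m k) = replicate k c"
    by (auto simp: diag_mat_def intro: nth_equalityI)
  finally show ?thesis by simp
qed

text \<open>A rotation by an odd multiple of pi also has eigenvalue -1, so the multiplicity may
  exceed \<open>l\<close>, but only by an even amount.\<close>

lemma even_order_canonical_form_iff:
  "even (Polynomial.order (- 1) (char_poly (orthogonal_canonical_form k l s \<alpha>))) \<longleftrightarrow> even l"
proof -
  have cp1: "char_poly (1\<^sub>m k :: real mat) = [:- 1, 1:] ^ k"
  proof -
    have "1 \<cdot>\<^sub>m 1\<^sub>m k = (1\<^sub>m k :: real mat)" by (rule eq_matI) auto
    then show ?thesis using char_poly_smult_one[of "1 :: real" k] by simp
  qed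
  have "- 1\<^sub>m l = (- 1 :: real) \<cdot>\<^sub>m 1\<^sub>m l" by (rule eq_matI) auto
  \<comment> \<open>The double negation is kept to match the shape of \<open>order_power_n_n\<close>
    at the point -1.\<close>
  then have cpm: "char_poly (- 1\<^sub>m l :: real mat) = [:- (- 1), 1:] ^ l"
    using char_poly_smult_one[of "- 1 :: real" l] by simp
  \<comment> \<open>Nonvanishing is carried through the induction because orders add only for
    nonzero products.\<close>
  have rot: "prod_list (map (\<lambda>i. char_poly (rotation_block (\<alpha> i))) js) \<noteq> 0 \<and>
     even (Polynomial.order (- 1) (prod_list (map (\<lambda>i. char_poly (rotation_block (\<alpha> i))) js)))"
    for js :: "nat list"
  proof (induction js)
    case (Cons i js)
    have "char_poly (rotation_block (\<alpha> i)) \<noteq> 0" by (simp add: char_poly_rotation_block)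
    with Cons show ?case using even_order_rotation_block[of "\<alpha> i"] by (simp add: order_mult)
  qed simp
  let ?r = "prod_list (map (\<lambda>i. char_poly (rotation_block (\<alpha> i))) [1..<s + 1])"
  have "char_poly (orthogonal_canonical_form k l s \<alpha>)
      = [:- 1, 1:] ^ k * ([:- (- 1), 1:] ^ l * ?r)"
    unfolding orthogonal_canonical_form_def
    by (subst char_poly_diag_block_mat) (auto simp: cp1 cpm o_def carrier_matD[OF rotation_block_carrier])
  moreover have "poly ([:- 1, 1:] ^ k) (- 1 :: real) \<noteq> 0"
    by (simp only: poly_power) simp
  then have "Polynomial.order (- 1) ([:- 1, 1:] ^ k :: real poly) = 0"
    by (rule order_0I)
  moreover have "Polynomial.order (- 1) ([:- (- 1), 1:] ^ l :: real poly) = l"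
    by (rule order_power_n_n)
  moreover have "[:- 1, 1:] ^ k \<noteq> (0 :: real poly)" "[:- (- 1), 1:] ^ l \<noteq> (0 :: real poly)"
    by simp_all
  ultimately have "Polynomial.order (- 1) (char_poly (orthogonal_canonical_form k l s \<alpha>))
      = l + Polynomial.order (- 1) ?r"
    using rot[of "[1..<s + 1]"] by (simp only: order_mult mult_eq_0_iff simp_thms add_0)
  then show ?thesis using rot[of "[1..<s + 1]"] by (simp only: even_add simp_thms)
qed

section \<open>Transport of the blockwise root from the canonical form to \<open>A\<close>\<close>

theorem theorem2p7:
  fixes k l s n :: nat and \<alpha> :: "nat \<Rightarrow> real" and A :: "real mat"
  assumes "n = k + 2 * s + l"
    and "real_orthogonal_mat n A"
    and "similar_mat A (orthogonal_canonical_form k l s \<alpha>)"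
    and "even (Polynomial.order (- 1) (char_poly A))"
  shows "\<exists>R. real_orthogonal_mat n R \<and> R ^\<^sub>m 2 = A"
proof -
  let ?C = "orthogonal_canonical_form k l s \<alpha>"
  have "even l"
    using assms(4) char_poly_similar[OF assms(3)] even_order_canonical_form_iff by metis
  then have "has_orthogonal_root ?C"
    unfolding orthogonal_canonical_form_def
    by (intro diag_block_mat_has_orthogonal_root)
       (auto simp: one_has_orthogonal_root uminus_one_has_orthogonal_root
         rotation_block_has_orthogonal_root)
  moreover have A: "A \<in> carrier_mat n n" using assms(2) by (simp add: real_orthogonal_mat_def)
  moreover have "dim_row ?C = n" using similar_matD[OF assms(3)] A by auto
  ultimately obtain D where D: "real_orthogonal_mat n D" "D * D = ?C"
    by (auto simp: has_orthogonal_root_def)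
  \<comment> \<open>The canonical form is orthogonal because it is the square of the orthogonal
    matrix \<open>D\<close>.\<close>
  then have "real_orthogonal_mat n ?C" using real_orthogonal_mat_mult[OF D(1) D(1)] by simp
  then obtain Q where Qo: "real_orthogonal_mat n Q" and Q: "A = transpose_mat Q * ?C * Q"
    using similar_real_orthogonal assms(2,3) by blast
  \<comment> \<open>Conjugating by the orthogonal \<open>Q\<close> keeps the root orthogonal; in
    \<open>R * R\<close> the inner factor Q Q^t cancels.\<close>
  define R where "R = transpose_mat Q * (D * Q)"
  have R: "real_orthogonal_mat n R"
    unfolding R_def using D Qo by (intro real_orthogonal_mat_mult real_orthogonal_mat_transpose)
  note assoc = assoc_mult_mat[of _ n n _ n _ n] mult_carrier_mat[of _ n n _ n]
  have c: "Q \<in> carrier_mat n n" "D \<in> carrier_mat n n" "Q * transpose_mat Q = 1\<^sub>m n"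
    using Qo D by (auto simp: real_orthogonal_mat_def)
  have "R * R = transpose_mat Q * (D * D) * Q"
    unfolding R_def using c by (simp add: assoc mat_mult_cancel_left[where k = n, OF c(1) _ _ c(3)])
  then have "R * R = A" by (simp add: D Q)
  then show ?thesis using R pow_mat_2[of R n] by (auto simp: real_orthogonal_mat_def)
qed

end
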